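(* Let $r\in\{1,2\}$. If $x\in(0,1]$ and $N\to\infty$, $k=k(N)\in\{1,\dots,N\}$ with $k/N\to x$, then $$\lim T\varphi_N(k,r)=2\,(x^2-x-x\log x).$$ Moreover, with $k_2^\star=k_2^\star(N)=\inf\{1\le k\le N: T\varphi_N(k,r)\le\varphi_N(k,2)\}-1$ (which does not depend on $r\in\{1,2\}$), $$b=\lim_{N\to\infty}\frac{k_2^\star}{N}=-\frac23\,W\!\left(-\frac32\exp\left(-\frac32\right)\right)\cong 0.417188,$$ where $W$ is the (principal branch of the) Lambert $W$-function, i.e. the inverse function of $w\mapsto we^w$ on $[-1,\infty)$.
   Context: For an integer $N\ge 2$, let $\psi=\Gamma'/\Gamma$ be the digamma function and for $1\le k\le N$ put $$\varphi_N(k,1)=\frac{k}{N^2}\bigl(1+k-N-2N\psi(k)+2N\psi(N)\bigr),\qquad \varphi_N(k,2)=\frac{k(N-k+1)}{N^2},$$ and $\varphi_N(\infty,\infty)=0$. (This is the expected normalized time $\mathbf E[(T_k-k)/N\mid Y_k=r]$ during which the $k$-th of $N$ objects arriving in uniformly random order, having relative rank $Y_k=r$, remains best or second best among the objects observed so far.) Let $Y_1,\dots,Y_N$ be the relative ranks: independent with $\mathbf P\{Y_k=i\}=1/k$, $1\le i\le k$. The embedded Markov chain $W_t$ records the successive pairs $(s,Y_s)$ at times $s$ with $Y_s\le 2$: $W_0=(1,1)$, $W_t=(\gamma_t,Y_{\gamma_t})$ where $\gamma_0=1$, $\gamma_t=\inf\{s>\gamma_{t-1}: Y_s\le 2\}$,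 and $W_t=(\infty,\infty)$ if there is no such $s\le N$. Its one-step transition probabilities from $(k,r)$ to $(s,l)$, with $r,l\in\{1,2\}$, do not depend on $r,l$ and equal $$p(k,s)=\begin{cases}\frac12, & k=1,\ s=2,\\ \frac{k(k-1)}{s(s-1)(s-2)}, & 2\le k<s\le N,\\ 0,&\text{otherwise,}\end{cases}$$ with the remaining probability going to $(\infty,\infty)$, which is absorbing. The operator $T$ is the one-step mean: $$T\varphi_N(k,r)=\mathbf E_{(k,r)}\varphi_N(W_1)=\sum_{s=k+1}^N\ \sum_{l=1}^2 p(k,s)\,\varphi_N(s,l).$$ *)

theory Defs
  imports "HOL-Probability.Probability"
begin

text \<open>
  States \<^term>\<open>Some (k, r)\<close> stand for the pairs $(k,r)$, and \<^term>\<open>None\<close> for the absorbing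
  state $(\infty,\infty)$.
\<close>

type_synonym state = "(nat \<times> nat) option"

definition phi :: "nat \<Rightarrow> state \<Rightarrow> real" where
  "phi N w = (case w of
      None \<Rightarrow> 0
    | Some (k, r) \<Rightarrow>
        if r = 1 then
          real k / (real N)\<^sup>2 *
            (1 + real k - real N - 2 * real N * Digamma (real k) + 2 * real N * Digamma (real N))
        else if r = 2 then real k * (real N - real k + 1) / (real N)\<^sup>2
        else 0)"

text \<open>The joint law of the independent relative ranks $Y_1,\dots,Y_N$.\<close>

definition relative_ranks :: "nat \<Rightarrow> (nat \<Rightarrow> nat) pmf" where
  "relative_ranks N = Pi_pmf {1..N} 0 (\<lambda>k. pmf_of_set {1..k})"

definition next_times :: "nat \<Rightarrow> (nat \<Rightarrow> nat) \<Rightarrow> nat \<Rightarrow> nat set" where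
  "next_times N Y k = {s. k < s \<and> s \<le> N \<and> Y s \<le> 2}"

definition next_state :: "nat \<Rightarrow> (nat \<Rightarrow> nat) \<Rightarrow> nat \<Rightarrow> state" where
  "next_state N Y k =
     (if next_times N Y k = {} then None
      else Some (Inf (next_times N Y k), Y (Inf (next_times N Y k))))"

text \<open>
  One-step kernel of the embedded chain. As \<^term>\<open>next_state N Y k\<close> only involves $Y_s$ with $s > k$,
  it is independent of $Y_1,\dots,Y_k$. So the law of the next state, given that the current one
  is $(k,r)$, is its unconditional law; this also gives a meaning to the start in the unreachable
  state $(1,2)$. The explicit transition probabilities are derived in \<open>one_step_mean_eq\<close> below.
\<close>

definition kernel :: "nat \<Rightarrow> state \<Rightarrow> state pmf" where
  "kernel N w = (case w of
      None \<Rightarrow> return_pmf None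
    | Some (k, r) \<Rightarrow> map_pmf (\<lambda>Y. next_state N Y k) (relative_ranks N))"

definition one_step_mean :: "nat \<Rightarrow> (state \<Rightarrow> real) \<Rightarrow> state \<Rightarrow> real" where
  "one_step_mean N f w = measure_pmf.expectation (kernel N w) f"

definition trans_prob :: "nat \<Rightarrow> nat \<Rightarrow> nat \<Rightarrow> real" where
  "trans_prob N k s =
     (if k = 1 \<and> s = 2 then 1 / 2
      else if 2 \<le> k \<and> k < s \<and> s \<le> N then
        real k * (real k - 1) / (real s * (real s - 1) * (real s - 2))
      else 0)"

text \<open>By \<open>k2_star_set_nonempty\<close> below, the infimum is that of a nonempty set.\<close>

definition k2_star :: "nat \<Rightarrow> nat \<Rightarrow> int" where
  "k2_star N r =
     int (Inf {k. 1 \<le> k \<and> k \<le> N \<and>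
                  one_step_mean N (phi N) (Some (k, r)) \<le> phi N (Some (k, 2))}) - 1"

definition Lambert_W :: "real \<Rightarrow> real" where
  "Lambert_W = the_inv_into {-1..} (\<lambda>w. w * exp w)"


subsection \<open>Consistency of the definitions\<close>

lemma inj_on_mult_exp: "inj_on (\<lambda>w::real. w * exp w) {-1..}"
proof -
  have "strict_mono_on {-1..} (\<lambda>w::real. w * exp w)"
  proof (rule strict_mono_onI)
    fix x y :: real
    assume xy: "x \<in> {-1..}" "y \<in> {-1..}" "x < y"
    show "x * exp x < y * exp y"
    proof (rule DERIV_pos_imp_increasing_open[OF xy(3)])
      fix z assume "x < z" "z < y"
      hence "(z + 1) * exp z > 0" using xy by auto
      moreover have "((\<lambda>w. w * exp w) has_real_derivative (z + 1) * exp z) (at z)"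
        by (auto intro!: derivative_eq_intros simp: algebra_simps)
      ultimately show "\<exists>D. ((\<lambda>w. w * exp w) has_real_derivative D) (at z) \<and> 0 < D"
        by blast
    qed (intro continuous_intros)
  qed
  thus ?thesis by (rule strict_mono_on_imp_inj_on)
qed

lemma prod_survive:
  assumes "2 \<le> k" "k < s"
  shows "(\<Prod>j\<in>{k<..<s}. (real j - 2) / real j)
           = real k * (real k - 1) / ((real s - 1) * (real s - 2))"
  using assms(2)
proof (induction s)
  case (Suc s)
  show ?case
  proof (cases "s = k")
    case True
    have "{k<..<Suc k} = {}" by auto
    thus ?thesis using True assms by (auto simp: field_simps)
  next
    case False
    with Suc.prems have ks: "k < s" by simp
    have "{k<..<Suc s} = insert s {k<..<s}" using ks by auto
    hence "(\<Prod>j\<in>{k<..<Suc s}. (real j - 2) / real j)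
        = (real s - 2) / real s * (real k * (real k - 1) / ((real s - 1) * (real s - 2)))"
      using Suc.IH[OF ks] by simp
    also have "\<dots> = real k * (real k - 1) / (real s * (real s - 1))"
      using ks assms(1) by simp
    finally show ?thesis by simp
  qed
qed simp

lemma prob_unif:
  assumes "j \<ge> (1::nat)"
  shows "measure_pmf.prob (pmf_of_set {1..j}) B = real (card ({1..j} \<inter> B)) / real j"
  using assms by (subst measure_pmf_of_set) auto

lemma one_step_mean_eq:
  assumes k: "1 \<le> k" and f: "f None = 0"
  shows "one_step_mean N f (Some (k, r))
           = (\<Sum>s = k + 1..N. \<Sum>l = 1..2. trans_prob N k s * f (Some (s, l)))"
proof -
  let ?M = "relative_ranks N"
  define B where "B s l j = (if k < j \<and> j < s then {2<..} else if j = s then {l} else UNIV)"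
    for s l j :: nat
  have fin: "finite (set_pmf ?M)"
    unfolding relative_ranks_def
    by (subst set_Pi_pmf) (auto intro!: finite_PiE_dflt simp: set_pmf_of_set)
  have Y_ge: "Y j \<ge> 1" if "Y \<in> set_pmf ?M" "j \<in> {1..N}" for Y j
  proof -
    have "Y j \<in> set_pmf (pmf_of_set {1..j})"
      using that unfolding relative_ranks_def
      by (subst (asm) set_Pi_pmf) (auto simp: PiE_dflt_def)
    thus ?thesis using that by (subst (asm) set_pmf_of_set) auto
  qed
  have prob: "measure_pmf.prob ?M (Pi {1..N} (B s l)) = trans_prob N k s"
    if s: "s \<in> {k+1..N}" and l: "l \<in> {1..2}" for s l
  proof -
    have "measure_pmf.prob ?M (Pi {1..N} (B s l))
            = (\<Prod>j\<in>{1..N}. measure_pmf.prob (pmf_of_set {1..j}) (B s l j))"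
      unfolding relative_ranks_def by (rule measure_Pi_pmf_Pi) simp
    also have "\<dots> = (\<Prod>j\<in>insert s {k<..<s}. measure_pmf.prob (pmf_of_set {1..j}) (B s l j))"
      using s k by (intro prod.mono_neutral_right) (auto simp: B_def)
    also have "\<dots> = measure_pmf.prob (pmf_of_set {1..s}) {l}
        * (\<Prod>j\<in>{k<..<s}. measure_pmf.prob (pmf_of_set {1..j}) (B s l j))"
      by (subst prod.insert) (auto simp: B_def)
    also have "measure_pmf.prob (pmf_of_set {1..s}) {l} = 1 / real s"
    proof -
      have "{1..s} \<inter> {l} = {l}" using s l k by auto
      thus ?thesis using s k by (subst prob_unif) auto
    qed
    also have "(\<Prod>j\<in>{k<..<s}. measure_pmf.prob (pmf_of_set {1..j}) (B s l j))
        = (\<Prod>j\<in>{k<..<s}. (real j - 2) / real j)"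
    proof (rule prod.cong[OF refl])
      fix j assume j: "j \<in> {k<..<s}"
      have "{1..j} \<inter> {2<..} = {3..j}" by auto
      thus "measure_pmf.prob (pmf_of_set {1..j}) (B s l j) = (real j - 2) / real j"
        using j k by (subst prob_unif) (auto simp: B_def of_nat_diff)
    qed
    finally have eq: "measure_pmf.prob ?M (Pi {1..N} (B s l))
        = 1 / real s * (\<Prod>j\<in>{k<..<s}. (real j - 2) / real j)" .
    show ?thesis
    proof (cases "k = 1")
      case True
      show ?thesis
      proof (cases "s = 2")
        case True
        have "{Suc 0<..<2} = {}" by auto
        with True \<open>k = 1\<close> eq show ?thesis by (simp add: trans_prob_def)
      next
        case False
        hence "2 \<in> {k<..<s}" using s True by auto
        hence "(\<Prod>j\<in>{k<..<s}. (real j - 2) / real j) = 0"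
          by (intro prod_zero) auto
        thus ?thesis using eq False True by (simp add: trans_prob_def)
      qed
    next
      case False
      hence "2 \<le> k" "k < s" "s \<noteq> 2" using k s by auto
      with prod_survive[of k s] eq s show ?thesis
        by (simp add: trans_prob_def field_simps)
    qed
  qed
  have f_eq: "f (next_state N Y k)
      = (\<Sum>s = k + 1..N. \<Sum>l = 1..2. indicator (Pi {1..N} (B s l)) Y * f (Some (s, l)))"
    if Y: "Y \<in> set_pmf ?M" for Y
  proof (cases "next_times N Y k = {}")
    case True
    have "Y \<notin> Pi {1..N} (B s l)" if "s \<in> {k+1..N}" "l \<in> {1..2}" for s l
    proof
      assume "Y \<in> Pi {1..N} (B s l)"
      hence "Y s \<in> B s l s" using that k by (auto simp: Pi_def)
      hence "s \<in> next_times N Y k" using that by (auto simp: B_def next_times_def)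
      thus False using True by simp
    qed
    thus ?thesis using True f by (simp add: next_state_def indicator_def)
  next
    case False
    define t where "t = Inf (next_times N Y k)"
    have t: "t \<in> next_times N Y k" unfolding t_def by (rule Inf_nat_def1[OF False])
    hence tN: "t \<in> {k+1..N}" and Yt: "Y t \<le> 2" by (auto simp: next_times_def)
    have Yt1: "Y t \<in> {1..2}" using Y_ge[OF Y, of t] tN Yt by auto
    have least: "t \<le> s" if "s \<in> next_times N Y k" for s
      unfolding t_def using that by (simp add: wellorder_Inf_le1)
    have iff: "Y \<in> Pi {1..N} (B s l) \<longleftrightarrow> s = t \<and> l = Y t"
      if sl: "s \<in> {k+1..N}" "l \<in> {1..2}" for s l
    proof
      assume *: "Y \<in> Pi {1..N} (B s l)"
      hence "Y s \<in> B s l s" using sl k by (auto simp: Pi_def)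
      hence Ys: "Y s = l" by (simp add: B_def)
      hence "t \<le> s" using sl by (intro least) (auto simp: next_times_def)
      moreover have "\<not> t < s"
      proof
        assume "t < s"
        moreover have "Y t \<in> B s l t" using * tN k by (auto simp: Pi_def)
        ultimately have "Y t > 2" using tN by (auto simp: B_def)
        thus False using Yt by simp
      qed
      ultimately show "s = t \<and> l = Y t" using Ys by auto
    next
      assume *: "s = t \<and> l = Y t"
      have "Y j > 2" if "k < j" "j < t" for j
      proof (rule ccontr)
        assume "\<not> Y j > 2"
        hence "j \<in> next_times N Y k" using that tN by (auto simp: next_times_def)
        thus False using least that by fastforce
      qed
      thus "Y \<in> Pi {1..N} (B s l)" using * by (auto simp: B_def)
    qed
    have "(\<Sum>s = k + 1..N. \<Sum>l = 1..2. indicator (Pi {1..N} (B s l)) Y * f (Some (s, l)))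
        = (\<Sum>s = k + 1..N. \<Sum>l = 1..2. if s = t \<and> l = Y t then f (Some (s, l)) else 0)"
    proof (intro sum.cong refl)
      fix s l assume "s \<in> {k+1..N}" "l \<in> {1..2::nat}"
      from iff[OF this]
      show "indicator (Pi {1..N} (B s l)) Y * f (Some (s, l))
          = (if s = t \<and> l = Y t then f (Some (s, l)) else 0)"
        by (cases "s = t \<and> l = Y t") (simp_all only: indicator_def if_True if_False, simp_all)
    qed
    also have "\<dots> = (\<Sum>s = k + 1..N. if s = t then f (Some (t, Y t)) else 0)"
    proof (intro sum.cong refl)
      fix s
      have "(\<Sum>l = 1..2. if l = Y t then f (Some (t, l)) else 0) = f (Some (t, Y t))"
        using Yt1 by (subst sum.delta) auto
      thus "(\<Sum>l = 1..2. if s = t \<and> l = Y t then f (Some (s, l)) else 0)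
          = (if s = t then f (Some (t, Y t)) else 0)" by auto
    qed
    also have "\<dots> = f (Some (t, Y t))" using tN by (subst sum.delta) auto
    finally show ?thesis using False by (simp add: next_state_def t_def)
  qed
  have int: "integrable (measure_pmf ?M) g" for g :: "_ \<Rightarrow> real"
    using fin by (rule integrable_measure_pmf_finite)
  have "one_step_mean N f (Some (k, r)) = measure_pmf.expectation ?M (\<lambda>Y. f (next_state N Y k))"
    by (simp add: one_step_mean_def kernel_def)
  also have "\<dots> = measure_pmf.expectation ?M
     (\<lambda>Y. \<Sum>s = k + 1..N. \<Sum>l = 1..2. indicator (Pi {1..N} (B s l)) Y * f (Some (s, l)))"
    by (intro integral_cong_AE) (auto simp: AE_measure_pmf_iff f_eq)
  also have "\<dots> = (\<Sum>s = k + 1..N. \<Sum>l = 1..2. measure_pmf.expectation ?M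
     (\<lambda>Y. indicator (Pi {1..N} (B s l)) Y * f (Some (s, l))))"
    by (simp only: Bochner_Integration.integral_sum int)
  also have "\<dots> = (\<Sum>s = k + 1..N. \<Sum>l = 1..2. trans_prob N k s * f (Some (s, l)))"
    by (intro sum.cong refl) (simp flip: prob)
  finally show ?thesis .
qed

lemma k2_star_set_nonempty:
  assumes "N \<ge> 1"
  shows "N \<in> {k. 1 \<le> k \<and> k \<le> N \<and>
                 one_step_mean N (phi N) (Some (k, r)) \<le> phi N (Some (k, 2))}"
proof -
  have "phi N None = 0" by (simp add: phi_def)
  from one_step_mean_eq[where f = "phi N" and N = N and k = N and r = r, OF assms this]
  have "one_step_mean N (phi N) (Some (N, r)) = 0" by simp
  thus ?thesis using assms by (simp add: phi_def)
qed

end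

theory Submission
  imports Defs
begin

text \<open>
  Both statements follow from a closed form for the one-step mean. The two payoffs at time $s$ add up
  to $\frac2N\bigl(1+s(H_N-H_s)\bigr)$, where $H$ denotes the harmonic numbers, because the linear terms cancel
  and $\psi(n)=H_n-\frac1n-\gamma$. The sum of these against $k(k-1)/(s(s-1)(s-2))$
  telescopes (\<open>mean_phi_step\<close>, \<open>one_step_mean_phi\<close>) to
  \[ T\varphi_N(k,r)=\frac{2k}{N}\Bigl(\frac{k-1}{N}+H_N-H_k-1\Bigr)+\frac2N . \]
  With $k/N\to x$ the difference $H_N-H_k$ tends to $-\log x$, which is the first limit.

  For the threshold, let $f(x)=3x-2\log x-3$. Then
  \[ T\varphi_N(k,r)-\varphi_N(k,2)
     =\frac kN\Bigl(\frac{3k}{N}+2\,(H_{N-1}-H_{k-1})-3-\frac1N\Bigr), \]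
  whose limit is $x\,f(x)$. The function $f$ is strictly decreasing on $(0,\frac23]$ and has a single
  zero $b$ there. Just above $b$ the limit is negative, so stopping is eventually
  allowed at every fraction slightly larger than $b$; this bounds the first stopping index from above.
  A bound from below needs control over all $k\le cN$ at once, for $c<b$. It comes from
  $H_{N-1}-H_{k-1}\ge\log(N/k)$: if stopping at $k$ is allowed, then $f(k/N)\le\frac1N$
  (\<open>stop_gap_le_if_stop\<close>), and monotonicity of $f$ turns this into $k/N>c$ for large $N$.

  Finally $f(b)=0$ says $-\frac32b\,e^{-\frac32b}=-\frac32e^{-\frac32}$, and $b\le\frac23$ puts
  $-\frac32b$ on the principal branch of the Lambert function. The decimal value
  comes from the signs of $f$ at two rational points that enclose $b$.
\<close>

section \<open>A closed form for the one-step mean\<close>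

lemma Digamma_real_of_nat:
  assumes "n \<ge> 1"
  shows "Digamma (real n) = harm n - 1 / real n - euler_mascheroni"
proof -
  obtain m where m: "n = Suc m" using assms by (cases n) auto
  have "Digamma (real n) = harm m - euler_mascheroni"
    unfolding m by (rule Digamma_of_nat)
  thus ?thesis by (simp add: m harm_Suc inverse_eq_divide)
qed

text \<open>
  Adding the payoffs of both ranks removes the terms $\pm(s-N)$. The Digamma values, once written
  through $H_s$ and $H_N$ rather than $H_{s-1}$ and $H_{N-1}$, absorb the remaining constant.
\<close>

lemma phi_rank_sum:
  assumes "1 \<le> s" "1 \<le> N"
  shows "phi N (Some (s, 1)) + phi N (Some (s, 2))
           = 2 / real N * (1 + real s * (harm N - harm s))"
  using assms by (simp add: phi_def Digamma_real_of_nat field_simps power2_eq_square)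

definition mean_phi :: "nat \<Rightarrow> nat \<Rightarrow> real" where
  "mean_phi N k = 2 * real k / real N * ((real k - 1) / real N + (harm N - harm k) - 1) + 2 / real N"

lemma mean_phi_self: "1 \<le> N \<Longrightarrow> mean_phi N N = 0"
  by (simp add: mean_phi_def field_simps power2_eq_square)

text \<open>
  Division by $k(k-1)$ frees the transition probabilities of their dependence on the
  starting time $k$, so that the closed form becomes a telescoping primitive of the summand.
\<close>

lemma mean_phi_step:
  assumes "2 \<le> k" "1 \<le> N"
  shows "mean_phi N k / (real k * (real k - 1))
           = mean_phi N (Suc k) / (real (Suc k) * (real (Suc k) - 1))
             + 2 / real N * (1 + real (Suc k) * (harm N - harm (Suc k)))
               / (real (Suc k) * (real (Suc k) - 1) * (real (Suc k) - 2))"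
proof -
  define x M d :: real where "x = real k" and "M = real N" and "d = harm N - harm (Suc k)"
  have nz: "x \<noteq> 0" "x - 1 \<noteq> 0" "x + 1 \<noteq> 0" "M \<noteq> 0"
    using assms by (auto simp: x_def M_def)
  have harm_k: "harm N - harm k = d + 1 / (x + 1)"
    by (simp add: d_def harm_Suc x_def field_simps)
  have Suc_k: "real (Suc k) = x + 1" by (simp add: x_def)
  have "(2 * x / M * ((x - 1) / M + (d + 1 / (x + 1)) - 1) + 2 / M) / (x * (x - 1))
      = (2 * (x + 1) / M * ((x + 1 - 1) / M + d - 1) + 2 / M) / ((x + 1) * (x + 1 - 1))
        + 2 / M * (1 + (x + 1) * d) / ((x + 1) * (x + 1 - 1) * (x + 1 - 2))"
  proof -
    have e: "x + 1 - 1 = x" "x + 1 - 2 = x - 1" by simp_all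
    show ?thesis using nz unfolding e by (simp add: divide_simps) (simp add: algebra_simps)
  qed
  thus ?thesis
    unfolding mean_phi_def harm_k Suc_k x_def[symmetric] M_def[symmetric] d_def[symmetric] .
qed

text \<open>
  The telescoping sum covers $k\ge2$. From $k=1$ the chain can only move to $s=2$, and the closed form
  happens to give the right value there too, also in the degenerate case $N=1$.
\<close>

lemma one_step_mean_phi:
  assumes "1 \<le> k" "k \<le> N"
  shows "one_step_mean N (phi N) (Some (k, r)) = mean_phi N k"
proof -
  have N: "1 \<le> N" using assms by simp
  define v where "v s = 2 / real N * (1 + real s * (harm N - harm s))" for s
  have "one_step_mean N (phi N) (Some (k, r))
      = (\<Sum>s = k + 1..N. \<Sum>l = 1..2. trans_prob N k s * phi N (Some (s, l)))"
    using assms(1) by (rule one_step_mean_eq) (simp add: phi_def)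
  also have "\<dots> = (\<Sum>s = k + 1..N. trans_prob N k s * v s)"
  proof (rule sum.cong[OF refl])
    fix s assume "s \<in> {k + 1..N}"
    hence "v s = phi N (Some (s, 1)) + phi N (Some (s, 2))"
      unfolding v_def using phi_rank_sum[of s N] N by simp
    moreover have "{1..2::nat} = {1, 2}" by auto
    ultimately show "(\<Sum>l = 1..2. trans_prob N k s * phi N (Some (s, l))) = trans_prob N k s * v s"
      by (simp add: distrib_left)
  qed
  also have "\<dots> = mean_phi N k"
  proof (cases "k = 1")
    case True
    show ?thesis
    proof (cases "N = 1")
      case False
      have "(\<Sum>s = k + 1..N. trans_prob N k s * v s) = (\<Sum>s \<in> {2}. trans_prob N k s * v s)"
        using True False N by (intro sum.mono_neutral_right) (auto simp: trans_prob_def)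
      also have "\<dots> = mean_phi N k"
        using True N by (simp add: trans_prob_def v_def mean_phi_def harm_expand field_simps)
      finally show ?thesis .
    qed (use True in \<open>simp add: mean_phi_self\<close>)
  next
    case False
    hence k: "2 \<le> k" using assms by simp
    have tail: "(\<Sum>s = j + 1..N. v s / (real s * (real s - 1) * (real s - 2)))
        = mean_phi N j / (real j * (real j - 1))" if "2 \<le> j" "j \<le> N" for j
      using that(2,1)
    proof (induction rule: inc_induct)
      case base
      show ?case using N by (simp add: mean_phi_self)
    next
      case (step n)
      have "{n + 1..N} = insert (Suc n) {Suc n + 1..N}" using step.hyps by auto
      thus ?case using step mean_phi_step[of n N] N by (simp add: v_def)
    qed
    have "(\<Sum>s = k + 1..N. trans_prob N k s * v s)
        = real k * (real k - 1) * (\<Sum>s = k + 1..N. v s / (real s * (real s - 1) * (real s - 2)))"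
      unfolding sum_distrib_left using k
      by (intro sum.cong refl) (simp add: trans_prob_def)
    also have "\<dots> = mean_phi N k"
      using k assms(2) by (subst tail) auto
    finally show ?thesis .
  qed
  finally show ?thesis .
qed

section \<open>Limits of the mean and of the stopping condition\<close>

text \<open>
  As $x>0$ forces $k(N)\to\infty$, both $H_N-\log N$ and $H_{k(N)}-\log k(N)$ tend to Euler's
  constant, and their difference leaves only $\log (k(N)/N)$.
\<close>

lemma tendsto_harm_diff:
  fixes x :: real
  assumes "x > 0" and k: "(\<lambda>N. real (k N) / real N) \<longlonglongrightarrow> x"
  shows "(\<lambda>N. harm N - harm (k N)) \<longlonglongrightarrow> - ln x"
proof -
  have lim: "filterlim (\<lambda>N. real (k N) / real N * real N) at_top sequentially"
    using k \<open>x > 0\<close> filterlim_real_sequentially by (rule filterlim_tendsto_pos_mult_at_top)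
  have eq: "\<forall>\<^sub>F N in sequentially. real (k N) / real N * real N = real (k N)"
    using eventually_gt_at_top[of 0] by eventually_elim simp
  have "filterlim (\<lambda>N. real (k N)) at_top sequentially"
    by (rule iffD1[OF filterlim_cong[OF refl refl eq] lim])
  hence k_top: "filterlim k at_top sequentially"
    by (simp add: filterlim_sequentially_iff_filterlim_real)
  have "(\<lambda>N. (harm N - ln (real N)) - (harm (k N) - ln (real (k N))) - ln (real (k N) / real N))
          \<longlonglongrightarrow> euler_mascheroni - euler_mascheroni - ln x"
    using \<open>x > 0\<close>
    by (intro tendsto_diff euler_mascheroni_LIMSEQ tendsto_ln k
        filterlim_compose[OF euler_mascheroni_LIMSEQ k_top]) auto
  moreover have "\<forall>\<^sub>F N in sequentially.
      (harm N - ln (real N)) - (harm (k N) - ln (real (k N))) - ln (real (k N) / real N)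
        = harm N - harm (k N)"
    using eventually_gt_at_top[of 0] eventually_compose_filterlim[OF eventually_gt_at_top[of 0] k_top]
    by eventually_elim (simp add: ln_div)
  ultimately show ?thesis
    by (simp add: tendsto_cong)
qed

lemma tendsto_mean_phi:
  fixes x :: real
  assumes "x > 0" and k: "(\<lambda>N. real (k N) / real N) \<longlonglongrightarrow> x"
  shows "(\<lambda>N. mean_phi N (k N)) \<longlonglongrightarrow> 2 * (x\<^sup>2 - x - x * ln x)"
proof -
  have inv: "(\<lambda>N. 1 / real N) \<longlonglongrightarrow> 0" by (rule lim_1_over_n)
  have "(\<lambda>N. 2 * (real (k N) / real N) * (real (k N) / real N - 1 / real N
            + (harm N - harm (k N)) - 1) + 2 * (1 / real N))
        \<longlonglongrightarrow> 2 * x * (x - 0 + - ln x - 1) + 2 * 0"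
    by (intro tendsto_intros k inv tendsto_harm_diff[OF assms])
  thus ?thesis
    by (simp add: mean_phi_def diff_divide_distrib algebra_simps power2_eq_square)
qed

text \<open>
  The limit of $\frac Nk\bigl(T\varphi_N(k,r)-\varphi_N(k,2)\bigr)$ when $k/N\to x$: it is positive where
  continuing is better in the limit than stopping on a second best object.
\<close>

definition stop_gap :: "real \<Rightarrow> real" where
  "stop_gap x = 3 * x - 2 * ln x - 3"

text \<open>
  The right-hand side is $H_{N-1}-H_{k-1}=\sum_{j=k}^{N-1}\frac1j$, a left Riemann sum of the
  decreasing function $1/t$ on $[k,N]$.
\<close>

lemma ln_le_harm_diff:
  assumes "1 \<le> k" "k \<le> N"
  shows "ln (real N) - ln (real k) \<le> harm N - harm k - 1 / real N + 1 / real k"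
  using assms(2)
proof (induction rule: dec_induct)
  case (step n)
  have "ln (real n + 1) - ln (real n) < 1 / real n"
    using step assms by (intro ln_diff_le_inverse) auto
  thus ?case using step.IH by (simp add: harm_Suc inverse_eq_divide add.commute)
qed simp

lemma mean_phi_minus_phi:
  assumes "1 \<le> k" "k \<le> N"
  shows "mean_phi N k - phi N (Some (k, 2))
    = real k / real N * (3 * (real k / real N) + 2 * (harm N - harm k - 1 / real N + 1 / real k) - 3 - 1 / real N)"
proof -
  define x M d :: real where "x = real k" and "M = real N" and "d = harm N - harm k"
  have nz: "x \<noteq> 0" "M \<noteq> 0" using assms by (auto simp: x_def M_def)
  show ?thesis using nz
    by (simp add: mean_phi_def phi_def power2_eq_square flip: x_def M_def d_def)
       (simp add: field_simps)
qed

text \<open>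
  A version of the stopping condition that is uniform in $k$. Convergence along sequences
  $k(N)$ could not exclude all small indices, among them those with $k/N\to0$.
\<close>

lemma stop_gap_le_if_stop:
  assumes "1 \<le> k" "k \<le> N" "mean_phi N k \<le> phi N (Some (k, 2))"
  shows "stop_gap (real k / real N) \<le> 1 / real N"
proof -
  have "real k / real N > 0" using assms by simp
  moreover have "mean_phi N k - phi N (Some (k, 2)) \<le> 0" using assms by simp
  ultimately have "3 * (real k / real N)
      + 2 * (harm N - harm k - 1 / real N + 1 / real k) - 3 - 1 / real N \<le> 0"
    unfolding mean_phi_minus_phi[OF assms(1,2)] by (simp only: mult_le_0_iff) linarith
  thus ?thesis
    using ln_le_harm_diff[OF assms(1,2)] assms by (simp add: stop_gap_def ln_div)
qed

lemma tendsto_mean_phi_minus_phi: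
  fixes x :: real
  assumes "x > 0" and k: "(\<lambda>N. real (k N) / real N) \<longlonglongrightarrow> x"
  shows "(\<lambda>N. mean_phi N (k N) - phi N (Some (k N, 2))) \<longlonglongrightarrow> x * stop_gap x"
proof -
  have inv: "(\<lambda>N. 1 / real N) \<longlonglongrightarrow> 0" by (rule lim_1_over_n)
  have "(\<lambda>N. mean_phi N (k N) - real (k N) / real N * (1 - real (k N) / real N + 1 / real N))
      \<longlonglongrightarrow> 2 * (x\<^sup>2 - x - x * ln x) - x * (1 - x + 0)"
    using assms by (intro tendsto_intros tendsto_mean_phi inv)
  also have "2 * (x\<^sup>2 - x - x * ln x) - x * (1 - x + 0) = x * stop_gap x"
    by (simp add: stop_gap_def algebra_simps power2_eq_square)
  finally show ?thesis
  proof (rule Lim_transform_eventually)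
    show "\<forall>\<^sub>F N in sequentially.
        mean_phi N (k N) - real (k N) / real N * (1 - real (k N) / real N + 1 / real N)
          = mean_phi N (k N) - phi N (Some (k N, 2))"
      using eventually_gt_at_top[of 0]
      by eventually_elim (simp add: phi_def power2_eq_square field_simps)
  qed
qed

section \<open>The zero of the limiting gap\<close>

lemma continuous_on_stop_gap: "A \<subseteq> {0<..} \<Longrightarrow> continuous_on A stop_gap"
  unfolding stop_gap_def by (intro continuous_intros) auto

lemma stop_gap_strict_antimono:
  assumes "0 < x" "x < y" "y \<le> 2 / 3"
  shows "stop_gap y < stop_gap x"
proof (rule DERIV_neg_imp_decreasing_open[OF assms(2)])
  fix z assume z: "x < z" "z < y"
  hence "(stop_gap has_real_derivative 3 - 2 / z) (at z)"
    unfolding stop_gap_def using assms by (auto intro!: derivative_eq_intros)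
  moreover have "3 - 2 / z < 0" using z assms by (simp add: field_simps)
  ultimately show "\<exists>D. (stop_gap has_real_derivative D) (at z) \<and> D < 0" by blast
next
  show "continuous_on {x..y} stop_gap"
    using assms by (intro continuous_on_stop_gap) auto
qed

text \<open>
  The other real zero of the gap is $1$, which gives the trivial solution $w=-\frac32$ on the lower
  branch. The bound $b\le\frac23$, that is $-\frac32b\ge-1$, singles out the principal branch.
\<close>

lemma Lambert_W_if_stop_gap_zero:
  assumes "0 < b" "b \<le> 2 / 3" "stop_gap b = 0"
  shows "- (2 / 3) * Lambert_W (- (3 / 2) * exp (- (3 / 2))) = b"
proof -
  have "exp (- (3 / 2)) = exp (ln b + - (3 / 2 * b))"
    using assms(3) by (simp add: stop_gap_def)
  also have "\<dots> = b * exp (- (3 / 2 * b))"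
    using assms(1) by (simp only: exp_add exp_ln)
  finally have "- (3 / 2) * exp (- (3 / 2)) = - (3 / 2 * b) * exp (- (3 / 2 * b))" by simp
  hence "Lambert_W (- (3 / 2) * exp (- (3 / 2)))
      = the_inv_into {-1..} (\<lambda>w. w * exp w) (- (3 / 2 * b) * exp (- (3 / 2 * b)))"
    by (simp only: Lambert_W_def)
  also have "\<dots> = - (3 / 2 * b)"
    using assms by (intro the_inv_into_f_f[OF inj_on_mult_exp]) auto
  finally show ?thesis by simp
qed


text \<open>
  The zero is $0.41718835\ldots$, inside the required interval $0.417188\pm5\cdot10^{-7}$ but
  not in its middle. The left point is the left end $0.4171875=\frac{267}{640}$ of that interval. The right
  one, $\frac{733}{1757}=0.41718838\ldots$, is a fraction with a small denominator between the zero and the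
  right end. The numbers of series terms used for the logarithms make the errors smaller than
  the gaps at these points, which are about $1.5\cdot10^{-6}$ and $-6\cdot10^{-8}$.
\<close>

lemma stop_gap_root_bounds:
  "stop_gap (267 / 640) > 0" "stop_gap (733 / 1757) < 0"
proof -
  have "ln (640 / 267 :: real) > 1119 / 1280"
    using ln_approx_bounds[of "640 / 267" 7] by (simp add: eval_nat_numeral)
  moreover have "ln (267 / 640 :: real) = - ln (640 / 267)"
    by (simp add: ln_div)
  ultimately show "stop_gap (267 / 640) > 0" by (simp add: stop_gap_def)
  have "ln (1757 / 733 :: real) < 1536 / 1757"
    using ln_approx_bounds[of "1757 / 733" 9] by (simp add: eval_nat_numeral)
  moreover have "ln (733 / 1757 :: real) = - ln (1757 / 733)"
    by (simp add: ln_div)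
  ultimately show "stop_gap (733 / 1757) < 0" by (simp add: stop_gap_def)
qed

lemma stop_gap_root_exists:
  obtains b where "267 / 640 < b" "b < 733 / 1757" "stop_gap b = 0"
proof -
  have "\<exists>b\<ge>267 / 640. b \<le> 733 / 1757 \<and> stop_gap b = 0"
    using stop_gap_root_bounds
    by (intro IVT2' continuous_on_stop_gap) auto
  then obtain b where "267 / 640 \<le> b" "b \<le> 733 / 1757" "stop_gap b = 0" by blast
  moreover from this have "b \<noteq> 267 / 640" "b \<noteq> 733 / 1757"
    using stop_gap_root_bounds by (metis less_irrefl)+
  ultimately show thesis by (intro that) auto
qed

section \<open>The threshold for stopping on a second best object\<close>

lemma k2_star_eq:
  "k2_star N r = int (LEAST k. 1 \<le> k \<and> k \<le> N \<and> mean_phi N k \<le> phi N (Some (k, 2))) - 1"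
  by (simp add: k2_star_def Inf_nat_def one_step_mean_phi cong: conj_cong)

text \<open>
  The lower bound on the first stopping index uses the uniform inequality
  \<open>stop_gap_le_if_stop\<close>. For the upper bound it suffices that stopping is allowed at one index near
  $cN$ with $c$ slightly above $b$, since the first index cannot exceed it. The bound $\frac23$
  keeps $c$ where the gap is decreasing.
\<close>

lemma tendsto_k2_star:
  assumes b: "0 < b" "b < 2 / 3" "stop_gap b = 0"
  shows "(\<lambda>N. real_of_int (k2_star N r) / real N) \<longlonglongrightarrow> b"
proof -
  define stops where "stops N k \<longleftrightarrow> 1 \<le> k \<and> k \<le> N \<and> mean_phi N k \<le> phi N (Some (k, 2))" for N k
  define first where "first N = (LEAST k. stops N k)" for N
  have k2: "k2_star N r = int (first N) - 1" for N
    by (simp add: k2_star_eq first_def stops_def)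
  have "stops N N" if "1 \<le> N" for N
    using that by (simp add: stops_def mean_phi_self phi_def)
  hence stops_first: "stops N (first N)" if "1 \<le> N" for N
    unfolding first_def using that by (meson LeastI)
  have first_le: "first N \<le> k" if "stops N k" for N k
    unfolding first_def using that by (rule Least_le)
  have inv: "(\<lambda>N. 1 / real N) \<longlonglongrightarrow> 0" by (rule lim_1_over_n)
  show ?thesis
  proof (rule order_tendstoI)
    fix a assume "a < b"
    then obtain c where c: "max a 0 < c" "c < b"
      using b dense[of "max a 0" b] by auto
    have "stop_gap c > 0"
      using stop_gap_strict_antimono[of c b] b c by simp
    hence "\<forall>\<^sub>F N in sequentially. 1 / real N < stop_gap c"
      using inv by (intro order_tendstoD)
    moreover have "\<forall>\<^sub>F N in sequentially. 1 / real N < c - a"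
      using inv c by (intro order_tendstoD) auto
    moreover have "\<forall>\<^sub>F N :: nat in sequentially. 1 \<le> N"
      by (rule eventually_ge_at_top)
    ultimately show "\<forall>\<^sub>F N in sequentially. a < real_of_int (k2_star N r) / real N"
    proof eventually_elim
      case (elim N)
      have first: "stops N (first N)" using elim by (intro stops_first)
      have "stop_gap (real (first N) / real N) < stop_gap c"
        using stop_gap_le_if_stop[of "first N" N] first elim by (simp add: stops_def)
      moreover have "real (first N) / real N > 0" using first by (simp add: stops_def)
      ultimately have "\<not> real (first N) / real N \<le> c"
        using stop_gap_strict_antimono[of "real (first N) / real N" c] b c
        by (auto simp: order_le_less)
      thus ?case using elim by (simp add: k2 diff_divide_distrib)
    qed
  next
    fix a assume "b < a"
    then obtain c where c: "b < c" "c < min a (2 / 3)"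
      using b dense[of b "min a (2 / 3)"] by auto
    \<comment> \<open>Rounding up keeps the index positive, and the $-1$ in the definition of $k_2^\star$ makes up for it.\<close>
    define k where "k N = nat \<lceil>c * real N\<rceil>" for N
    have k_lim: "(\<lambda>N. real (k N) / real N) \<longlonglongrightarrow> c"
    proof (rule tendsto_sandwich)
      show "\<forall>\<^sub>F N in sequentially. c \<le> real (k N) / real N"
        using eventually_gt_at_top[of 0]
      proof eventually_elim
        case (elim N)
        thus ?case by (simp add: k_def field_simps real_nat_ceiling_ge)
      qed
      show "\<forall>\<^sub>F N in sequentially. real (k N) / real N \<le> c + 1 / real N"
        using eventually_gt_at_top[of 0]
      proof eventually_elim
        case (elim N)
        have "c * real N \<ge> 0" using b c by simp
        hence "real (k N) \<le> c * real N + 1" unfolding k_def by linarith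
        thus ?case using elim by (simp add: field_simps)
      qed
      show "(\<lambda>N. c + 1 / real N) \<longlonglongrightarrow> c" using tendsto_add[OF tendsto_const inv, of c] by simp
    qed simp
    have "c * stop_gap c < 0"
      using stop_gap_strict_antimono[of b c] b c by (simp add: mult_less_0_iff)
    hence "\<forall>\<^sub>F N in sequentially. mean_phi N (k N) - phi N (Some (k N, 2)) < 0"
      using b c k_lim by (intro order_tendstoD(2)[OF tendsto_mean_phi_minus_phi]) auto
    moreover have "\<forall>\<^sub>F N :: nat in sequentially. 1 \<le> N"
      by (rule eventually_ge_at_top)
    ultimately show "\<forall>\<^sub>F N in sequentially. real_of_int (k2_star N r) / real N < a"
    proof eventually_elim
      case (elim N)
      have pos: "c * real N > 0" using elim b c by simp
      have "c * real N \<le> real N" using elim c by (simp add: mult_le_cancel_right1)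
      hence "stops N (k N)" using elim pos unfolding stops_def k_def by simp linarith
      hence "real (first N) \<le> real (k N)" by (simp add: first_le)
      also have "real (k N) < c * real N + 1" using pos unfolding k_def by linarith
      also have "c * real N \<le> a * real N" using c by (intro mult_right_mono) auto
      finally have "real (first N) - 1 < a * real N" by simp
      thus ?case using elim by (simp add: k2 field_simps)
    qed
  qed
qed

theorem lemma2:
  fixes r :: nat
  assumes "r \<in> {1, 2}"
  shows
    "(\<forall>(x::real) (k :: nat \<Rightarrow> nat).
        0 < x \<and> x \<le> 1 \<longrightarrow>
        (\<forall>N\<ge>2. k N \<in> {1..N}) \<longrightarrow>
        (\<lambda>N. real (k N) / real N) \<longlonglongrightarrow> x \<longrightarrow>
        (\<lambda>N. one_step_mean N (phi N) (Some (k N, r))) \<longlonglongrightarrow> 2 * (x\<^sup>2 - x - x * ln x))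
     \<and> (\<forall>N\<ge>2. k2_star N 1 = k2_star N 2)
     \<and> (\<lambda>N. real_of_int (k2_star N r) / real N)
          \<longlonglongrightarrow> - (2 / 3) * Lambert_W (- (3 / 2) * exp (- (3 / 2)))
     \<and> \<bar>- (2 / 3) * Lambert_W (- (3 / 2) * exp (- (3 / 2))) - 0.417188\<bar> < 5 / 10 ^ 7"
proof -
  obtain b where b: "267 / 640 < b" "b < 733 / 1757" "stop_gap b = 0"
    by (rule stop_gap_root_exists)
  hence W: "- (2 / 3) * Lambert_W (- (3 / 2) * exp (- (3 / 2))) = b"
    by (intro Lambert_W_if_stop_gap_zero) auto
  have "(\<lambda>N. one_step_mean N (phi N) (Some (k N, r))) \<longlonglongrightarrow> 2 * (x\<^sup>2 - x - x * ln x)"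
    if x: "0 < x" and k: "\<forall>N\<ge>2. k N \<in> {1..N}" and lim: "(\<lambda>N. real (k N) / real N) \<longlonglongrightarrow> x"
    for x :: real and k
  proof (rule Lim_transform_eventually[OF tendsto_mean_phi[OF x lim]])
    show "\<forall>\<^sub>F N in sequentially. mean_phi N (k N) = one_step_mean N (phi N) (Some (k N, r))"
      using eventually_ge_at_top[of 2]
      by eventually_elim (use k in \<open>simp add: one_step_mean_phi\<close>)
  qed
  moreover have "k2_star N 1 = k2_star N 2" for N
    by (simp add: k2_star_eq)
  moreover have "(\<lambda>N. real_of_int (k2_star N r) / real N) \<longlonglongrightarrow> b"
    using b by (intro tendsto_k2_star) auto
  moreover have "\<bar>b - 0.417188\<bar> < 5 / 10 ^ 7"
    using b by (simp add: abs_if)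
  ultimately show ?thesis unfolding W by blast
qed

end
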